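(* Let $X\subset\mathbb{R}^n$ be a compact set with nonempty interior and let $F=(f_1,\dots,f_r)$, with $f_\ell:\mathbb{R}^n\to\mathbb{R}$, be continuous. Suppose that: (A1$'$) $X$ is robust and closed; (A2$'$) the functions $f_\ell$, $\ell=1,\dots,r$, are continuous; (A3$'$) there exist an index $\ell_0$ and $\gamma_0\in\mathbb{R}$ such that $\{x\in X\mid f_{\ell_0}(x)\le \gamma_0\}$ is compact. Let $w\in W^{*}$, and let $\{c_k\}_{k\ge 0}$ be the infinite sequence generated by the mean value of level sets algorithm (with tolerance $\varepsilon=0$), that is, $c_0\in\mathbb{R}$ is such that $\{x\in X\mid\Psi_w(x)\le c_0\}\ne\emptyset$, and $$c_{k+1}=M(\Psi_w,c_k,X)\quad\text{for all } k\ge 0.$$ Then $\{c_k\}$ is convergent and its limit $\overline{c}=\lim_{k\to\infty}c_k$ is the global minimum value of $\Psi_w$ over $X$. Furthermore, $H_{\overline{c}}\cap X=\{x\in X\mid\Psi_w(x)\le\overline{c}\}$ is the set of global minimizers of $\Psi_w$ over $X$, and consequently it is a subset of the set of weak Pareto optimal solutions of the multiobjective problem of minimizing $F(x)=(f_1(x),\dots,f_r(x))$ subject to $x\in X$.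
   Context: A point $\overline{x}\in X$ is weak Pareto optimal if there is no $x\in X$ with $f_\ell(x)<f_\ell(\overline{x})$ for all $\ell=1,\dots,r$. A set $D\subset\mathbb{R}^n$ is robust if $\operatorname{cl}(D)=\operatorname{cl}(\operatorname{int}D)$. Weights: $W^{*}=\{w\in\mathbb{R}^r\mid w_\ell>0,\ \ell=1,\dots,r,\ \|w\|_1=1\}$, where $\|w\|_1=\sum_{\ell=1}^r|w_\ell|$. Weighted Chebyshev scalarization: $\Psi_w(x)=\max_{\ell=1,\dots,r}\{w_\ell(f_\ell(x)-u_\ell^* )\}$. Here $u^*=F^*-\xi$, with $F^*=(f_1^*,\dots,f_r^* )$, $f_\ell^*=\min_{x\in X}f_\ell(x)$, and $\xi\in\mathbb{R}^r_+\setminus\{0\}$ fixed. Let $H_c=\{x\in\mathbb{R}^n\mid\Psi_w(x)\le c\}$. Mean value: let $\mu$ be Lebesgue measure on $\mathbb{R}^n$. For $c>\min_{x\in X}\Psi_w(x)$, $$M(\Psi_w,c,X)=\frac{1}{\mu(H_c\cap X)}\int_{H_c\cap X}\Psi_w(x)\,d\mu.$$ For $c=\min_{x\in X}\Psi_w(x)$, $$M(\Psi_w,c,X)=\lim_{c_j'\downarrow c}\frac{1}{\mu(H_{c_j'}\cap X)}\int_{H_{c_j'}\cap X}\Psi_w(x)\,d\mu$$ for any sequence $\{c_j'\}$ decreasing to $c$ (the limit exists and does not depend on the sequence). *)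

theory Defs
  imports "HOL-Analysis.Analysis"
begin

definition robust :: "'a::topological_space set \<Rightarrow> bool" where
  "robust D \<longleftrightarrow> closure D = closure (interior D)"

definition is_min_value :: "('a \<Rightarrow> real) \<Rightarrow> 'a set \<Rightarrow> real \<Rightarrow> bool" where
  "is_min_value g X m \<longleftrightarrow> m \<in> g ` X \<and> (\<forall>x\<in>X. m \<le> g x)"

text \<open>Meaningful only when the minimum is attained.\<close>
definition min_value :: "('a \<Rightarrow> real) \<Rightarrow> 'a set \<Rightarrow> real" where
  "min_value g X = (THE m. is_min_value g X m)"

definition weak_Pareto :: "('a \<Rightarrow> real ^ 'r) \<Rightarrow> 'a set \<Rightarrow> 'a set" where
  "weak_Pareto F X = {xb \<in> X. \<not> (\<exists>x\<in>X. \<forall>l. F x $ l < F xb $ l)}"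

definition weights :: "(real ^ 'r::finite) set" where
  "weights = {w. (\<forall>l. w $ l > 0) \<and> (\<Sum>l\<in>UNIV. \<bar>w $ l\<bar>) = 1}"

definition ideal_point :: "('a \<Rightarrow> real ^ 'r) \<Rightarrow> 'a set \<Rightarrow> real ^ 'r" where
  "ideal_point F X = (\<chi> l. min_value (\<lambda>x. F x $ l) X)"

definition chebyshev ::
    "('a \<Rightarrow> real ^ 'r::finite) \<Rightarrow> 'a set \<Rightarrow> real ^ 'r \<Rightarrow> real ^ 'r \<Rightarrow> 'a \<Rightarrow> real" where
  "chebyshev F X \<xi> w x =
     (let u = ideal_point F X - \<xi> in MAX l\<in>UNIV. w $ l * (F x $ l - u $ l))"

definition level_set :: "('a \<Rightarrow> real) \<Rightarrow> real \<Rightarrow> 'a set" where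
  "level_set g c = {x. g x \<le> c}"

definition level_average :: "('a::euclidean_space \<Rightarrow> real) \<Rightarrow> real \<Rightarrow> 'a set \<Rightarrow> real" where
  "level_average g c X =
     1 / measure lebesgue (level_set g c \<inter> X) * (LINT x:level_set g c \<inter> X|lebesgue. g x)"

text \<open>At the minimum value the level set may be a null set, so the mean value is the common
  limit of the averages along all sequences decreasing to \<open>c\<close> from strictly above. Values of \<open>c\<close>
  below the minimum carry no meaning.\<close>
definition mean_value :: "('a::euclidean_space \<Rightarrow> real) \<Rightarrow> real \<Rightarrow> 'a set \<Rightarrow> real" where
  "mean_value g c X =
     (if is_min_value g X c
      then THE m. \<forall>c'. decseq c' \<and> (\<forall>j. c < c' j) \<and> c' \<longlonglongrightarrow> c
                    \<longrightarrow> (\<lambda>j. level_average g (c' j) X) \<longlonglongrightarrow> m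
      else level_average g c X)"

end

theory Submission
  imports Defs
begin

text \<open>
  The convergence does not depend on the special form of the scalarization: it holds for every
  function \<open>g\<close> that is continuous on a compact robust set \<open>X\<close>. Let \<open>m\<close> be the minimum of \<open>g\<close>
  over \<open>X\<close>.

  Robustness gives sublevel sets mass: if \<open>m < a\<close>, then \<open>{x \<in> X. g x < a}\<close> is relatively open
  and contains a minimizer, which is a limit of interior points of \<open>X\<close>; so it contains a nonempty
  open set and has positive measure (\<open>robust_sublevel_measure_pos\<close>). Hence the average of \<open>g\<close> over
  \<open>{x \<in> X. g x \<le> c}\<close>, for \<open>m < c\<close>, is a true average and lies between \<open>m\<close> and \<open>c\<close>. Squeezing
  shows that the mean value at \<open>c = m\<close> is \<open>m\<close> itself, so the iteration descends and stays
  above \<open>m\<close>; it therefore converges to some \<open>L\<close> with \<open>m \<le> L\<close>.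

  If \<open>m < L\<close>, let \<open>a\<close> be strictly between the two. For every \<open>c \<ge> L\<close> the set
  \<open>A = {x \<in> X. g x \<le> a}\<close> is part of the level set, it has positive measure, and on it \<open>g\<close> is
  smaller than \<open>c\<close> by at least \<open>L - a\<close>. This lowers the average below \<open>c\<close> by at least
  \<open>(L - a) \<mu>(A) / \<mu>(X)\<close>, a positive amount independent of \<open>c\<close> (\<open>level_average_upper\<close>). A
  convergent sequence cannot decrease by a fixed amount at each step, so \<open>L = m\<close>.

  The Chebyshev function is continuous, as a maximum of finitely many continuous functions, and
  strictly monotone in the objective values because all weights are positive. Thus a point that
  improves all the objectives has a smaller Chebyshev value, and minimizers are weak Pareto optimal.
\<close>

section \<open>Averages over level sets\<close>

lemma compact_level_set_Int:
  fixes g :: "'a::euclidean_space \<Rightarrow> real"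
  assumes "compact X" "continuous_on X g"
  shows "compact (level_set g c \<inter> X)"
proof -
  have "closed (X \<inter> g -` {..c})"
    using assms by (intro continuous_closed_preimage compact_imp_closed closed_atMost)
  moreover have "level_set g c \<inter> X = X \<inter> (X \<inter> g -` {..c})"
    by (auto simp: level_set_def)
  ultimately show ?thesis
    using assms(1) by (metis compact_Int_closed)
qed

lemma set_integrable_lebesgue_compact:
  fixes g :: "'a::euclidean_space \<Rightarrow> real"
  assumes "compact K" "continuous_on K g"
  shows "set_integrable lebesgue K g"
  using borel_integrable_compact[OF assms]
  by (simp add: set_integrable_def integrable_completion borel_measurable_integrable)

text \<open>
  This is where robustness enters. A minimizer may lie on the boundary of \<open>X\<close>, and in a
  general compact set it could even be an isolated point, so that the level sets just above the minimum
  are null sets. Robustness puts interior points of \<open>X\<close> in every neighbourhood of it, and by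
  continuity those close by have values below \<open>a\<close>.
\<close>
lemma robust_sublevel_measure_pos:
  fixes g :: "'a::euclidean_space \<Rightarrow> real"
  assumes X: "compact X" "robust X" and g: "continuous_on X g"
    and m: "is_min_value g X m" and "m < a"
  shows "measure lebesgue (level_set g a \<inter> X) > 0"
proof -
  obtain x0 where x0: "x0 \<in> X" "g x0 = m"
    using m by (auto simp: is_min_value_def)
  have "openin (top_of_set X) (X \<inter> g -` {..<a})"
    using g by (simp add: continuous_openin_preimage_gen)
  then obtain T where T: "open T" "X \<inter> g -` {..<a} = X \<inter> T"
    by (auto simp: openin_open)
  have "x0 \<in> T"
    using x0 \<open>m < a\<close> T(2) by auto
  moreover have "x0 \<in> closure (interior X)"
    using x0(1) X(2) closure_subset[of X] by (auto simp: robust_def)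
  ultimately have ne: "T \<inter> interior X \<noteq> {}"
    using T(1) by (auto simp: closure_iff_nhds_not_empty)
  have sub: "T \<inter> interior X \<subseteq> level_set g a \<inter> X"
  proof
    fix x
    assume "x \<in> T \<inter> interior X"
    then have "x \<in> X \<inter> g -` {..<a}"
      using T(2) interior_subset[of X] by blast
    then show "x \<in> level_set g a \<inter> X"
      by (simp add: level_set_def)
  qed
  have "level_set g a \<inter> X \<in> lmeasurable"
    using compact_level_set_Int[OF X(1) g] by (rule lmeasurable_compact)
  moreover have "\<not> negligible (level_set g a \<inter> X)"
    using ne sub T(1) by (meson negligible_subset open_Int open_interior open_not_negligible)
  ultimately show ?thesis
    by (metis negligible_iff_measure zero_less_measure_iff)
qed

lemma level_average_ge:
  fixes g :: "'a::euclidean_space \<Rightarrow> real"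
  assumes X: "compact X" "continuous_on X g"
    and pos: "measure lebesgue (level_set g c \<inter> X) > 0"
    and m: "\<And>x. x \<in> X \<Longrightarrow> m \<le> g x"
  shows "m \<le> level_average g c X"
proof -
  let ?K = "level_set g c \<inter> X"
  have K: "compact ?K" "?K \<in> lmeasurable"
    using compact_level_set_Int[OF X] lmeasurable_compact by auto
  have "set_integrable lebesgue ?K g"
    using K(1) X(2) by (intro set_integrable_lebesgue_compact) (auto intro: continuous_on_subset)
  moreover have "set_integrable lebesgue ?K (\<lambda>_. m)"
    using K(1) by (intro set_integrable_lebesgue_compact continuous_on_const)
  ultimately have "(LINT x:?K|lebesgue. m) \<le> (LINT x:?K|lebesgue. g x)"
    using m by (intro set_integral_mono) auto
  then have "measure lebesgue ?K * m \<le> (LINT x:?K|lebesgue. g x)"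
    using K(2) by (simp add: set_lebesgue_integral_def fmeasurable_def mult.commute)
  then show ?thesis
    using pos by (simp add: level_average_def field_simps)
qed

text \<open>
  Integrate the pointwise bound of \<open>g\<close> by \<open>a\<close> on the lower level set and by \<open>c\<close> on the rest.
  The measure in the denominator is then enlarged to that of \<open>X\<close>, so that for \<open>c\<close> bounded away
  from \<open>a\<close> the decrement is bounded away from zero.
\<close>
lemma level_average_upper:
  fixes g :: "'a::euclidean_space \<Rightarrow> real"
  assumes X: "compact X" "continuous_on X g"
    and pos: "measure lebesgue (level_set g c \<inter> X) > 0"
    and "a \<le> c"
  shows "level_average g c X
           \<le> c - (c - a) * measure lebesgue (level_set g a \<inter> X) / measure lebesgue X"
proof -
  let ?K = "level_set g c \<inter> X" and ?A = "level_set g a \<inter> X"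
  let ?\<mu> = "measure (lebesgue :: 'a measure)"
  have K: "compact ?K" "?K \<in> lmeasurable" and A: "?A \<in> lmeasurable"
    using compact_level_set_Int[OF X] lmeasurable_compact by auto
  have KX: "?\<mu> ?K \<le> ?\<mu> X"
    using K(2) lmeasurable_compact[OF X(1)] by (intro measure_mono_fmeasurable) auto
  have int_g: "integrable lebesgue (\<lambda>x. indicator ?K x *\<^sub>R g x)"
    using set_integrable_lebesgue_compact[OF K(1) continuous_on_subset[OF X(2)]]
    by (simp add: set_integrable_def)
  have int_ind: "integrable lebesgue (indicator S :: 'a \<Rightarrow> real)" if "S \<in> lmeasurable" for S
    using that by (auto simp: fmeasurable_def)
  have int_bound: "integrable lebesgue (\<lambda>x. c * indicator ?K x - (c - a) * indicator ?A x)"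
    by (intro Bochner_Integration.integrable_diff integrable_mult_right int_ind K(2) A)
  have bound: "indicator ?K x *\<^sub>R g x \<le> c * indicator ?K x - (c - a) * indicator ?A x" for x
  proof (cases "x \<in> ?A")
    case True
    with \<open>a \<le> c\<close> have "x \<in> ?K" "g x \<le> a"
      by (auto simp: level_set_def)
    with True show ?thesis
      by simp
  next
    case False
    then show ?thesis
      by (cases "x \<in> ?K") (auto simp: level_set_def)
  qed
  have "(LINT x:?K|lebesgue. g x)
          \<le> (LINT x|lebesgue. c * indicator ?K x - (c - a) * indicator ?A x)"
    unfolding set_lebesgue_integral_def by (intro integral_mono int_g int_bound bound)
  also have "\<dots> = (LINT x|lebesgue. c * indicator ?K x) - (LINT x|lebesgue. (c - a) * indicator ?A x)"
    by (intro Bochner_Integration.integral_diff integrable_mult_right int_ind K(2) A)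
  also have "\<dots> = c * ?\<mu> ?K - (c - a) * ?\<mu> ?A"
    by simp
  finally have "level_average g c X \<le> (c * ?\<mu> ?K - (c - a) * ?\<mu> ?A) / ?\<mu> ?K"
    using pos by (simp add: level_average_def divide_right_mono)
  also have "\<dots> = c - (c - a) * ?\<mu> ?A / ?\<mu> ?K"
    using pos by (simp add: field_simps)
  also have "\<dots> \<le> c - (c - a) * ?\<mu> ?A / ?\<mu> X"
    using pos KX \<open>a \<le> c\<close> by (intro diff_left_mono divide_left_mono) auto
  finally show ?thesis .
qed

corollary level_average_le:
  fixes g :: "'a::euclidean_space \<Rightarrow> real"
  assumes "compact X" "continuous_on X g" "measure lebesgue (level_set g c \<inter> X) > 0"
  shows "level_average g c X \<le> c"
  using level_average_upper[OF assms order_refl] by simp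

section \<open>The mean value iteration\<close>

lemma is_min_value_unique: "is_min_value g X m \<Longrightarrow> is_min_value g X m' \<Longrightarrow> m = m'"
  unfolding is_min_value_def by (metis imageE order_antisym)

text \<open>
  Averages over level sets at heights \<open>c' j > m\<close> lie between \<open>m\<close> and \<open>c' j\<close>, which squeezes them
  to \<open>m\<close>. So the minimum value is a fixed point of the iteration, including when it is reached
  after finitely many steps.
\<close>
lemma mean_value_at_min:
  fixes g :: "'a::euclidean_space \<Rightarrow> real"
  assumes X: "compact X" "robust X" "continuous_on X g" and m: "is_min_value g X m"
  shows "mean_value g m X = m"
proof -
  let ?P = "\<lambda>l. \<forall>c'. decseq c' \<and> (\<forall>j. m < c' j) \<and> c' \<longlonglongrightarrow> m
                    \<longrightarrow> (\<lambda>j. level_average g (c' j) X) \<longlonglongrightarrow> l"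
  have lim_m: "?P m"
  proof (intro allI impI, elim conjE)
    fix c' :: "nat \<Rightarrow> real"
    assume c': "\<forall>j. m < c' j" "c' \<longlonglongrightarrow> m"
    have pos: "measure lebesgue (level_set g (c' j) \<inter> X) > 0" for j
      using robust_sublevel_measure_pos[OF X m] c'(1) by blast
    have "m \<le> level_average g (c' j) X" "level_average g (c' j) X \<le> c' j" for j
      using level_average_ge[OF X(1,3) pos] level_average_le[OF X(1,3) pos] m
      by (auto simp: is_min_value_def)
    then show "(\<lambda>j. level_average g (c' j) X) \<longlonglongrightarrow> m"
      by (intro tendsto_sandwich[OF _ _ tendsto_const c'(2)] always_eventually allI)
  qed
  \<comment> \<open>The limit is determined because at least one admissible sequence exists.\<close>
  let ?d = "\<lambda>j::nat. m + 1 / real (Suc j)"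
  have "decseq ?d"
    by (auto simp: decseq_def intro!: divide_left_mono)
  moreover have "?d \<longlonglongrightarrow> m"
    using tendsto_add[OF tendsto_const LIMSEQ_Suc[OF lim_1_over_n], of m] by simp
  moreover have "\<forall>j. m < ?d j"
    by simp
  ultimately have d: "decseq ?d \<and> (\<forall>j. m < ?d j) \<and> ?d \<longlonglongrightarrow> m"
    by blast
  have "l = m" if "?P l" for l
    using LIMSEQ_unique[OF that[rule_format, OF d] lim_m[rule_format, OF d]] .
  with lim_m have "(THE l. ?P l) = m"
    by (rule the_equality)
  with m show ?thesis
    by (simp add: mean_value_def)
qed

lemma mean_value_above_min:
  assumes "is_min_value g X m" "m < c"
  shows "mean_value g c X = level_average g c X"
proof -
  have "\<not> is_min_value g X c"
    using is_min_value_unique[OF assms(1), of c] \<open>m < c\<close> by blast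
  then show ?thesis
    by (simp add: mean_value_def)
qed

lemma mean_value_bounds:
  fixes g :: "'a::euclidean_space \<Rightarrow> real"
  assumes X: "compact X" "robust X" "continuous_on X g"
    and m: "is_min_value g X m" and "m \<le> c"
  shows "m \<le> mean_value g c X" "mean_value g c X \<le> c"
proof -
  have "m \<le> mean_value g c X \<and> mean_value g c X \<le> c"
  proof (cases "c = m")
    case True
    then show ?thesis
      by (simp add: mean_value_at_min[OF X m])
  next
    case False
    with \<open>m \<le> c\<close> have "m < c"
      by simp
    note pos = robust_sublevel_measure_pos[OF X m this]
    have "m \<le> level_average g c X"
      using level_average_ge[OF X(1,3) pos] m by (simp add: is_min_value_def)
    then show ?thesis
      using level_average_le[OF X(1,3) pos] mean_value_above_min[OF m \<open>m < c\<close>] by simp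
  qed
  then show "m \<le> mean_value g c X" "mean_value g c X \<le> c"
    by auto
qed

text \<open>
  A limit \<open>L\<close> above \<open>m\<close> is excluded by the decrement \<open>\<eta>\<close>: it is positive because the level set at
  the intermediate height \<open>a\<close> has mass, and it serves for all \<open>k\<close> at once because \<open>c k \<ge> L > a\<close>.
\<close>
theorem mean_value_iteration_tendsto_min:
  fixes g :: "'a::euclidean_space \<Rightarrow> real"
  assumes X: "compact X" "robust X" "continuous_on X g"
    and m: "is_min_value g X m" and "m \<le> c 0"
    and step: "\<And>k. c (Suc k) = mean_value g (c k) X"
  shows "c \<longlonglongrightarrow> m"
proof -
  have lower: "m \<le> c k" for k
    by (induction k) (use \<open>m \<le> c 0\<close> mean_value_bounds(1)[OF X m] step in auto)
  then have dec: "decseq c"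
    using mean_value_bounds(2)[OF X m] step by (auto simp: decseq_Suc_iff)
  obtain L where L: "c \<longlonglongrightarrow> L" and Lle: "L \<le> c k" for k
    using decseq_convergent[OF dec] lower by metis
  have "m \<le> L"
    using L lower by (intro LIMSEQ_le_const) auto
  moreover have "\<not> m < L"
  proof
    assume "m < L"
    define a where "a = (m + L) / 2"
    let ?\<mu> = "measure (lebesgue :: 'a measure)"
    define \<eta> where "\<eta> = (L - a) * ?\<mu> (level_set g a \<inter> X) / ?\<mu> X"
    have a: "m < a" "a < L"
      using \<open>m < L\<close> by (auto simp: a_def)
    have posA: "?\<mu> (level_set g a \<inter> X) > 0"
      using robust_sublevel_measure_pos[OF X m a(1)] .
    also have "?\<mu> (level_set g a \<inter> X) \<le> ?\<mu> X"
      using lmeasurable_compact[OF X(1)] lmeasurable_compact[OF compact_level_set_Int[OF X(1,3)]]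
      by (intro measure_mono_fmeasurable) auto
    finally have posX: "?\<mu> X > 0" .
    have "\<eta> > 0"
      using posA posX a by (simp add: \<eta>_def)
    have "c (Suc k) \<le> c k - \<eta>" for k
    proof -
      have ck: "m < c k" "a \<le> c k"
        using Lle[of k] a \<open>m < L\<close> by auto
      have "c (Suc k) \<le> c k - (c k - a) * ?\<mu> (level_set g a \<inter> X) / ?\<mu> X"
        using level_average_upper[OF X(1,3) robust_sublevel_measure_pos[OF X m ck(1)] ck(2)]
          step[of k] mean_value_above_min[OF m ck(1)] by simp
      also have "\<dots> \<le> c k - \<eta>"
        unfolding \<eta>_def using Lle[of k] posA posX
        by (intro diff_left_mono divide_right_mono mult_right_mono) auto
      finally show ?thesis .
    qed
    moreover have "(\<lambda>k. c (Suc k)) \<longlonglongrightarrow> L" "(\<lambda>k. c k - \<eta>) \<longlonglongrightarrow> L - \<eta>"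
      using LIMSEQ_Suc[OF L] tendsto_diff[OF L tendsto_const] by auto
    ultimately have "L \<le> L - \<eta>"
      by (meson LIMSEQ_le)
    with \<open>\<eta> > 0\<close> show False
      by simp
  qed
  ultimately show ?thesis
    using L by simp
qed

section \<open>The Chebyshev scalarization\<close>

lemma continuous_on_Max:
  fixes f :: "'i \<Rightarrow> 'a::topological_space \<Rightarrow> real"
  assumes "finite I" "I \<noteq> {}" "\<And>i. i \<in> I \<Longrightarrow> continuous_on S (f i)"
  shows "continuous_on S (\<lambda>x. MAX i\<in>I. f i x)"
  using assms
proof (induction I rule: finite_ne_induct)
  case (singleton i)
  then show ?case
    by simp
next
  case (insert i I)
  then have "(MAX j\<in>insert i I. f j x) = max (f i x) (MAX j\<in>I. f j x)" for x
    by simp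
  with insert show ?case
    by (auto intro!: continuous_on_max)
qed

lemma continuous_on_chebyshev:
  fixes F :: "'a::topological_space \<Rightarrow> real ^ 'r::finite"
  assumes "\<And>l. continuous_on S (\<lambda>x. F x $ l)"
  shows "continuous_on S (chebyshev F X \<xi> w)"
  unfolding chebyshev_def Let_def
  by (intro continuous_on_Max continuous_intros assms) auto

lemma chebyshev_strict_mono:
  fixes F :: "'a \<Rightarrow> real ^ 'r::finite"
  assumes w: "\<And>l. w $ l > 0" and less: "\<And>l. F x $ l < F y $ l"
  shows "chebyshev F X \<xi> w x < chebyshev F X \<xi> w y"
proof -
  let ?t = "\<lambda>z l. w $ l * (F z $ l - (ideal_point F X - \<xi>) $ l)"
  have "?t x l < (MAX l\<in>UNIV. ?t y l)" for l
  proof -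
    have "?t x l < ?t y l"
      using w less by (intro mult_strict_left_mono) auto
    also have "\<dots> \<le> (MAX l\<in>UNIV. ?t y l)"
      by (intro Max_ge) auto
    finally show ?thesis .
  qed
  then show ?thesis
    by (simp add: chebyshev_def Let_def)
qed

lemma level_set_min_eq_arg_min:
  assumes "is_min_value g X m"
  shows "level_set g m \<inter> X = {x. is_arg_min g (\<lambda>x. x \<in> X) x}"
  using assms by (fastforce simp: is_min_value_def level_set_def is_arg_min_linorder)

lemma arg_min_chebyshev_weak_Pareto:
  fixes F :: "'a \<Rightarrow> real ^ 'r::finite"
  assumes "w \<in> weights" "is_arg_min (chebyshev F X \<xi> w) (\<lambda>x. x \<in> X) x"
  shows "x \<in> weak_Pareto F X"
proof -
  have "\<not> (\<forall>l. F y $ l < F x $ l)" if "y \<in> X" for y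
    using that assms chebyshev_strict_mono[of w F y x X \<xi>]
    by (auto simp: weights_def is_arg_min_def)
  then show ?thesis
    using assms(2) by (auto simp: weak_Pareto_def is_arg_min_def)
qed

section \<open>Convergence to the minimum of the scalarized problem\<close>

theorem theorem3p1:
  fixes X :: "(real ^ 'n::finite) set"
    and F :: "real ^ 'n \<Rightarrow> real ^ 'r::finite"
    and \<xi> w :: "real ^ 'r"
    and \<Psi> :: "real ^ 'n \<Rightarrow> real"
    and c :: "nat \<Rightarrow> real"
  assumes "compact X" and "interior X \<noteq> {}"
    and "continuous_on UNIV F"
    and A1: "robust X" "closed X"
    and A2: "\<And>l. continuous_on UNIV (\<lambda>x. F x $ l)"
    and A3: "\<exists>l0 \<gamma>0. compact {x \<in> X. F x $ l0 \<le> \<gamma>0}"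
    and xi: "\<And>l. \<xi> $ l \<ge> 0" "\<xi> \<noteq> 0"
    and w: "w \<in> weights"
    and Psi: "\<Psi> = chebyshev F X \<xi> w"
    and c_0: "{x \<in> X. \<Psi> x \<le> c 0} \<noteq> {}"
    and c_Suc: "\<And>k. c (Suc k) = mean_value \<Psi> (c k) X"
  shows "convergent c
    \<and> is_min_value \<Psi> X (lim c)
    \<and> level_set \<Psi> (lim c) \<inter> X = {x. is_arg_min \<Psi> (\<lambda>x. x \<in> X) x}
    \<and> level_set \<Psi> (lim c) \<inter> X \<subseteq> weak_Pareto F X"
proof -
  have cont: "continuous_on X \<Psi>"
    unfolding Psi using A2 by (intro continuous_on_chebyshev) (auto intro: continuous_on_subset)
  obtain x0 where "x0 \<in> X" "\<forall>x\<in>X. \<Psi> x0 \<le> \<Psi> x"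
    using continuous_attains_inf[OF \<open>compact X\<close> _ cont] c_0 by blast
  then have m: "is_min_value \<Psi> X (\<Psi> x0)"
    by (auto simp: is_min_value_def)
  have "\<Psi> x0 \<le> c 0"
    using c_0 \<open>\<forall>x\<in>X. \<Psi> x0 \<le> \<Psi> x\<close> by force
  then have lim: "c \<longlonglongrightarrow> \<Psi> x0"
    using mean_value_iteration_tendsto_min[OF \<open>compact X\<close> A1(1) cont m] c_Suc by blast
  then have "convergent c" "lim c = \<Psi> x0"
    by (auto simp: convergent_def limI)
  moreover have "{x. is_arg_min \<Psi> (\<lambda>x. x \<in> X) x} \<subseteq> weak_Pareto F X"
    unfolding Psi using arg_min_chebyshev_weak_Pareto[OF w, of F X \<xi>] by auto
  ultimately show ?thesis
    using m level_set_min_eq_arg_min[OF m] by simp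
qed

end
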